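(* Let $A,B\in su(1,1)$ be linearly independent over $\mathbb{R}$. The single-input control system $\dot X(t)=[A+u(t)B]X(t)$, $X(0)=I_2$, on $SU(1,1)$, whose admissible controls are all locally bounded measurable functions $u:[0,\infty)\to\mathbb{R}$, is small time local controllable on $SU(1,1)$ if $\langle B,B^{\dagger}\rangle<0$.
   Context: $SU(1,1)$ is the Lie group of complex matrices $\begin{pmatrix} a & b\\ \bar b & \bar a\end{pmatrix}$ with $|a|^2-|b|^2=1$. Its Lie algebra $su(1,1)$ is the real span of $\bar K_x=\frac12\begin{pmatrix}0&-i\\ i&0\end{pmatrix}$, $\bar K_y=\frac12\begin{pmatrix}0&-1\\-1&0\end{pmatrix}$, $\bar K_z=\frac12\begin{pmatrix}-i&0\\0&i\end{pmatrix}$. For matrices $M,N$ put $\langle M,N\rangle=2\,\mathrm{Tr}(MN^{\dagger})$, where $N^\dagger$ is the conjugate transpose of $N$; thus $\langle B,B^\dagger\rangle=2\,\mathrm{Tr}(B^2)$. For $t\ge 0$, the reachable set $R(t)$ is the set of all $X_f\in SU(1,1)$ for which there is an admissible control whose corresponding solution with $X(0)=I_2$ satisfies $X(t)=X_f$. The system is small time local controllable on $SU(1,1)$ if $I_2$ is an interior point (relative to $SU(1,1)$) of $R(t)$ for every $t>0$. *)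

theory Defs
  imports "HOL-Analysis.Analysis" "HOL-Library.Complex_Order"
begin

type_synonym cmat2 = "complex ^ 2 ^ 2"

definition SU11 :: "cmat2 set" where
  "SU11 = {M. \<exists>a b. M = vector [vector [a, b], vector [cnj b, cnj a]]
                   \<and> (cmod a)\<^sup>2 - (cmod b)\<^sup>2 = 1}"

definition Kx :: cmat2 where
  "Kx = (1/2) *\<^sub>R vector [vector [0, - \<i>], vector [\<i>, 0]]"

definition Ky :: cmat2 where
  "Ky = (1/2) *\<^sub>R vector [vector [0, - 1], vector [- 1, 0]]"

definition Kz :: cmat2 where
  "Kz = (1/2) *\<^sub>R vector [vector [- \<i>, 0], vector [0, \<i>]]"

text \<open>\<^term>\<open>span\<close> is the span over the reals, also on complex matrices.\<close>

definition su11 :: "cmat2 set" where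
  "su11 = span {Kx, Ky, Kz}"

definition dagger :: "cmat2 \<Rightarrow> cmat2" where
  "dagger M = (\<chi> i j. cnj (M $ j $ i))"

definition mat_ip :: "cmat2 \<Rightarrow> cmat2 \<Rightarrow> complex" where
  "mat_ip M N = 2 * trace (M ** dagger N)"

text \<open>Absolute continuity on \<open>[a, b]\<close>: the finite families of non-overlapping compact
  subintervals are the divisions \<open>D\<close> of subsets of \<open>[a, b]\<close>, and \<open>Inf k\<close>, \<open>Sup k\<close> are the
  endpoints of the interval \<open>k\<close>.\<close>

definition abs_cont_on :: "real \<Rightarrow> real \<Rightarrow> (real \<Rightarrow> 'a::real_normed_vector) \<Rightarrow> bool" where
  "abs_cont_on a b f \<longleftrightarrow>
     (\<forall>e>0. \<exists>d>0. \<forall>D. D division_of \<Union>D \<and> \<Union>D \<subseteq> {a..b} \<and> (\<Sum>k\<in>D. Sup k - Inf k) < d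
        \<longrightarrow> (\<Sum>k\<in>D. norm (f (Sup k) - f (Inf k))) < e)"

text \<open>Controls and trajectories are functions on \<open>[0, \<infinity>)\<close>; their values at negative times
  play no role.\<close>

definition admissible_control :: "(real \<Rightarrow> real) \<Rightarrow> bool" where
  "admissible_control u \<longleftrightarrow>
     u \<in> borel_measurable (lebesgue_on {0..}) \<and> (\<forall>T\<ge>0. bounded (u ` {0..T}))"

text \<open>Controls are only measurable, so solutions are meant in the sense of Caratheodory:
  locally absolutely continuous, with the differential equation holding almost everywhere.\<close>

definition is_solution :: "cmat2 \<Rightarrow> cmat2 \<Rightarrow> (real \<Rightarrow> real) \<Rightarrow> (real \<Rightarrow> cmat2) \<Rightarrow> bool" where
  "is_solution A B u X \<longleftrightarrow>
     (\<forall>t\<ge>0. X t \<in> SU11) \<and> X 0 = mat 1 \<and> (\<forall>T\<ge>0. abs_cont_on 0 T X) \<and>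
     (AE t in lebesgue_on {0..}.
        (X has_vector_derivative ((A + u t *\<^sub>R B) ** X t)) (at t within {0..}))"

definition reachable_set :: "cmat2 \<Rightarrow> cmat2 \<Rightarrow> real \<Rightarrow> cmat2 set" where
  "reachable_set A B t =
     {Xf \<in> SU11. \<exists>u X. admissible_control u \<and> is_solution A B u X \<and> X t = Xf}"

definition small_time_local_controllable :: "cmat2 \<Rightarrow> cmat2 \<Rightarrow> bool" where
  "small_time_local_controllable A B \<longleftrightarrow>
     (\<forall>t>0. mat 1 \<in> (top_of_set SU11) interior_of (reachable_set A B t))"

end

theory Submission
  imports Defs
begin

text \<open>
  The condition on \<open>B\<close> says \<open>det B > 0\<close>: \<open>B\<close> is elliptic and generates a circle in the group. For
  large \<open>c\<close> the matrix \<open>C = A + c B\<close> is elliptic as well, with frequency \<open>w\<close> given by \<open>w\<^sup>2 = det C\<close>, and this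
  frequency can be prescribed. Given \<open>t > 0\<close>, choose \<open>c\<close> such that \<open>w t\<close> is a positive multiple of \<open>2 \<pi>\<close>; then the
  trajectory of the constant control \<open>c\<close> is periodic and is back at the identity exactly at time \<open>t\<close>.

  Along this loop the linearized system is controllable. A change \<open>v\<close> of the control moves the
  end point by \<open>\<integral> v(\<tau>) e\<^sup>-\<^sup>\<tau>\<^sup>C B e\<^sup>\<tau>\<^sup>C d\<tau>\<close> to first order, and the conjugates of \<open>B\<close> rotate about the axis
  \<open>C\<close>. As \<open>A\<close> and \<open>B\<close> are independent, \<open>B\<close> has a component orthogonal to \<open>C\<close>, which sweeps out the plane orthogonal
  to \<open>C\<close>; as \<open>c\<close> is a simple root of \<open>det (A + c B) = w\<^sup>2\<close>, \<open>B\<close> also has a component along \<open>C\<close>. So all three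
  dimensions are reached.

  It suffices to change the constant value of the control on three short arcs (lemma
  \<open>three_arc_interior\<close>): the end point is then an explicit function of three real
  parameters (\<open>steerable_step\<close>), its derivative is an isomorphism onto the Lie algebra
  (\<open>eighth_turn_products\<close> and \<open>anticommuting_basis_independent\<close>), and an open mapping theorem in a
  chart at the identity gives a neighbourhood of reachable points
  (\<open>interior_in_SU11_from_chart\<close>).
\<close>

section \<open>The group, its Lie algebra and the determinant form\<close>

definition su_mat :: "complex \<Rightarrow> complex \<Rightarrow> cmat2" where
  "su_mat a b = vector [vector [a, b], vector [cnj b, cnj a]]"

lemma su_mat_nth [simp]:
  "su_mat a b $ 1 $ 1 = a" "su_mat a b $ 1 $ 2 = b"
  "su_mat a b $ 2 $ 1 = cnj b" "su_mat a b $ 2 $ 2 = cnj a"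
  by (simp_all add: su_mat_def)

lemma cmat2_eq_iff:
  fixes M N :: cmat2
  shows "M = N \<longleftrightarrow> M $ 1 $ 1 = N $ 1 $ 1 \<and> M $ 1 $ 2 = N $ 1 $ 2 \<and>
    M $ 2 $ 1 = N $ 2 $ 1 \<and> M $ 2 $ 2 = N $ 2 $ 2"
  by (auto simp: vec_eq_iff forall_2)

lemma cmat2_mult_nth:
  fixes M N :: cmat2
  shows "(M ** N) $ i $ j = M $ i $ 1 * N $ 1 $ j + M $ i $ 2 * N $ 2 $ j"
  by (simp add: matrix_matrix_mult_def sum_2)

lemma su_mat_mult: "su_mat a b ** su_mat c d = su_mat (a * c + b * cnj d) (a * d + b * cnj c)"
  by (simp add: cmat2_eq_iff cmat2_mult_nth algebra_simps)

lemma su_mat_add: "su_mat a b + su_mat c d = su_mat (a + c) (b + d)"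
  by (simp add: cmat2_eq_iff)

lemma su_mat_scaleR: "r *\<^sub>R su_mat a b = su_mat (r *\<^sub>R a) (r *\<^sub>R b)"
  by (simp add: cmat2_eq_iff)

lemma mat_1_eq_su_mat: "(mat 1 :: cmat2) = su_mat 1 0"
  by (simp add: cmat2_eq_iff mat_def)

lemma su_mat_in_SU11_iff: "su_mat a b \<in> SU11 \<longleftrightarrow> (cmod a)\<^sup>2 - (cmod b)\<^sup>2 = 1"
proof -
  have "su_mat a b = su_mat c d \<longleftrightarrow> a = c \<and> b = d" for c d
    by (auto simp: cmat2_eq_iff)
  then show ?thesis
    unfolding SU11_def su_mat_def[symmetric] by auto
qed

lemma SU11_E:
  assumes "M \<in> SU11"
  obtains a b where "M = su_mat a b" "(cmod a)\<^sup>2 - (cmod b)\<^sup>2 = 1"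
  using assms unfolding SU11_def su_mat_def by auto

lemma mat_1_in_SU11: "(mat 1 :: cmat2) \<in> SU11"
  by (simp add: mat_1_eq_su_mat su_mat_in_SU11_iff)

lemma SU11_mult:
  assumes "M \<in> SU11" "N \<in> SU11"
  shows "M ** N \<in> SU11"
proof -
  obtain a b where M: "M = su_mat a b" and ab: "(cmod a)\<^sup>2 - (cmod b)\<^sup>2 = 1"
    using assms(1) by (rule SU11_E)
  obtain c d where N: "N = su_mat c d" and cd: "(cmod c)\<^sup>2 - (cmod d)\<^sup>2 = 1"
    using assms(2) by (rule SU11_E)
  have "(cmod (a * c + b * cnj d))\<^sup>2 - (cmod (a * d + b * cnj c))\<^sup>2
      = ((cmod a)\<^sup>2 - (cmod b)\<^sup>2) * ((cmod c)\<^sup>2 - (cmod d)\<^sup>2)"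
    unfolding cmod_power2 by (simp add: algebra_simps power2_eq_square)
  then show ?thesis
    by (simp add: M N su_mat_mult su_mat_in_SU11_iff ab cd)
qed

lemma su11_iff: "M \<in> su11 \<longleftrightarrow> (\<exists>r b. M = su_mat (of_real r * \<i>) b)"
proof
  assume "M \<in> su11"
  then have "M \<in> span {Kx, Ky, Kz}"
    by (simp add: su11_def)
  moreover have "subspace {M. \<exists>r b. M = su_mat (of_real r * \<i>) b}"
  proof (rule subspaceI)
    show "0 \<in> {M. \<exists>r b. M = su_mat (of_real r * \<i>) b}"
      by (auto simp: cmat2_eq_iff intro!: exI[of _ 0])
  next
    fix M N assume "M \<in> {M. \<exists>r b. M = su_mat (of_real r * \<i>) b}" "N \<in> {M. \<exists>r b. M = su_mat (of_real r * \<i>) b}"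
    then obtain r b s d where "M = su_mat (of_real r * \<i>) b" "N = su_mat (of_real s * \<i>) d"
      by blast
    then have "M + N = su_mat (of_real (r + s) * \<i>) (b + d)"
      by (simp add: su_mat_add algebra_simps)
    then show "M + N \<in> {M. \<exists>r b. M = su_mat (of_real r * \<i>) b}"
      by blast
  next
    fix c M assume "M \<in> {M. \<exists>r b. M = su_mat (of_real r * \<i>) b}"
    then obtain r b where "M = su_mat (of_real r * \<i>) b"
      by blast
    then have "c *\<^sub>R M = su_mat (of_real (c * r) * \<i>) (c *\<^sub>R b)"
      by (simp add: cmat2_eq_iff scaleR_conv_of_real[where 'a=complex])
    then show "c *\<^sub>R M \<in> {M. \<exists>r b. M = su_mat (of_real r * \<i>) b}"
      by blast
  qed
  moreover have "Kx = su_mat (of_real 0 * \<i>) (- \<i> / 2)" "Ky = su_mat (of_real 0 * \<i>) (- 1 / 2)"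
    "Kz = su_mat (of_real (- 1 / 2) * \<i>) 0"
    by (simp_all add: cmat2_eq_iff Kx_def Ky_def Kz_def scaleR_conv_of_real[where 'a=complex])
  then have "{Kx, Ky, Kz} \<subseteq> {M. \<exists>r b. M = su_mat (of_real r * \<i>) b}"
    by blast
  ultimately show "\<exists>r b. M = su_mat (of_real r * \<i>) b"
    using span_minimal by blast
next
  assume "\<exists>r b. M = su_mat (of_real r * \<i>) b"
  then obtain r b where M: "M = su_mat (of_real r * \<i>) b" by blast
  have "M = (- 2 * Im b) *\<^sub>R Kx + (- 2 * Re b) *\<^sub>R Ky + (- 2 * r) *\<^sub>R Kz"
    by (simp add: M cmat2_eq_iff Kx_def Ky_def Kz_def scaleR_conv_of_real[where 'a=complex] complex_eq_iff)
  also have "\<dots> \<in> su11"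
    unfolding su11_def by (intro span_add span_scale span_base) auto
  finally show "M \<in> su11" .
qed

lemma su11_combination: "M \<in> su11 \<Longrightarrow> N \<in> su11 \<Longrightarrow> x *\<^sub>R M + y *\<^sub>R N \<in> su11"
  unfolding su11_def by (intro span_add span_scale)

lemma bounded_bilinear_cmat2_mult: "bounded_bilinear ((**) :: cmat2 \<Rightarrow> cmat2 \<Rightarrow> cmat2)"
  unfolding bilinear_conv_bounded_bilinear[symmetric] bilinear_def
  by (intro conjI allI linearI) (simp_all add: cmat2_eq_iff cmat2_mult_nth algebra_simps)

interpretation matmul: bounded_bilinear "(**) :: cmat2 \<Rightarrow> cmat2 \<Rightarrow> cmat2"
  by (rule bounded_bilinear_cmat2_mult)

text \<open>The determinant is real and quadratic on the Lie algebra, and \<^term>\<open>polar\<close> below is its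
  polarization. Since elements of the Lie algebra are traceless, the theorem of Cayley and Hamilton
  turns both into statements about squares and anticommutators; orthogonal elements anticommute.\<close>

definition rdet :: "cmat2 \<Rightarrow> real" where
  "rdet M = Re (det M)"

definition polar :: "cmat2 \<Rightarrow> cmat2 \<Rightarrow> real" where
  "polar M N = rdet (M + N) - rdet M - rdet N"

lemma rdet_pencil: "rdet (A + c *\<^sub>R B) = rdet A + c * polar A B + c\<^sup>2 * rdet B"
  by (simp add: polar_def rdet_def det_2 algebra_simps power2_eq_square)

lemma polar_pencil: "polar (A + c *\<^sub>R B) B = polar A B + 2 * c * rdet B"
  by (simp add: polar_def rdet_def det_2 algebra_simps power2_eq_square)

lemma rdet_su_mat: "rdet (su_mat (of_real r * \<i>) b) = r\<^sup>2 - (cmod b)\<^sup>2"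
  unfolding cmod_power2 by (simp add: rdet_def det_2 power2_eq_square)

lemma su11_anticommutator:
  assumes "M \<in> su11" "N \<in> su11"
  shows "M ** N + N ** M = (- polar M N) *\<^sub>R mat 1"
proof -
  obtain r b where M: "M = su_mat (of_real r * \<i>) b" using assms(1) su11_iff by blast
  obtain s d where N: "N = su_mat (of_real s * \<i>) d" using assms(2) su11_iff by blast
  show ?thesis
    by (simp add: M N polar_def rdet_def det_2 mat_1_eq_su_mat cmat2_eq_iff cmat2_mult_nth
        complex_eq_iff algebra_simps)
qed

lemma su11_square:
  assumes "M \<in> su11"
  shows "M ** M = (- rdet M) *\<^sub>R mat 1"
proof -
  obtain r b where M: "M = su_mat (of_real r * \<i>) b" using assms(1) su11_iff by blast
  show ?thesis
    by (simp add: M rdet_def det_2 mat_1_eq_su_mat cmat2_eq_iff cmat2_mult_nth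
        complex_eq_iff algebra_simps)
qed

lemma su11_anticommuting_product:
  assumes "M \<in> su11" "N \<in> su11" and "N ** M = - (M ** N)"
  shows "M ** N \<in> su11"
proof -
  obtain r b where M: "M = su_mat (of_real r * \<i>) b" using assms(1) su11_iff by blast
  obtain s d where N: "N = su_mat (of_real s * \<i>) d" using assms(2) su11_iff by blast
  have "Re (b * cnj d) = r * s"
    using arg_cong[OF assms(3), of "\<lambda>X. Re (X $ 1 $ 1)"]
    by (simp add: M N cmat2_mult_nth algebra_simps)
  then have "M ** N = su_mat (of_real (Im (b * cnj d)) * \<i>) (of_real r * \<i> * d - of_real s * \<i> * b)"
    by (simp add: M N su_mat_mult cmat2_eq_iff complex_eq_iff algebra_simps)
  then show ?thesis
    using su11_iff by blast
qed

section \<open>One-parameter groups of elliptic elements\<close>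

text \<open>This is \<open>exp (\<tau> C)\<close> when \<open>C\<close> is elliptic, that is \<open>C\<^sup>2 = - \<omega>\<^sup>2 I\<close> with \<open>\<omega>\<^sup>2 = det C > 0\<close>.\<close>

definition flow :: "cmat2 \<Rightarrow> real \<Rightarrow> cmat2" where
  "flow C \<tau> = cos (sqrt (rdet C) * \<tau>) *\<^sub>R mat 1 + (sin (sqrt (rdet C) * \<tau>) / sqrt (rdet C)) *\<^sub>R C"

lemma flow_0 [simp]: "flow C 0 = mat 1"
  by (simp add: flow_def)

lemma flow_in_SU11:
  assumes "C \<in> su11" "0 < rdet C"
  shows "flow C \<tau> \<in> SU11"
proof -
  obtain r b where C: "C = su_mat (of_real r * \<i>) b" using assms(1) su11_iff by blast
  define w where "w = sqrt (rdet C)"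
  have w: "w \<noteq> 0" "w\<^sup>2 = r\<^sup>2 - (cmod b)\<^sup>2"
    using assms(2) by (simp_all add: w_def C rdet_su_mat)
  have flow: "flow C \<tau> = su_mat (of_real (cos (w * \<tau>)) + of_real (sin (w * \<tau>) / w * r) * \<i>)
      (of_real (sin (w * \<tau>) / w) * b)"
    unfolding flow_def w_def[symmetric]
    by (simp add: C cmat2_eq_iff mat_def scaleR_conv_of_real[where 'a=complex])
  have "(cos (w * \<tau>))\<^sup>2 + (sin (w * \<tau>) / w * r)\<^sup>2 - (cmod (of_real (sin (w * \<tau>) / w) * b))\<^sup>2
     = (cos (w * \<tau>))\<^sup>2 + (sin (w * \<tau>) / w)\<^sup>2 * (r\<^sup>2 - (cmod b)\<^sup>2)"
    unfolding norm_mult norm_of_real power_mult_distrib power2_abs by (simp add: algebra_simps)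
  also have "\<dots> = 1"
    using w(1) unfolding w(2)[symmetric] by (simp add: power_divide)
  finally show ?thesis
    unfolding flow su_mat_in_SU11_iff by (simp add: cmod_power2)
qed

lemma flow_derivative:
  fixes C M :: cmat2
  assumes "C \<in> su11" "0 < rdet C"
  shows "((\<lambda>\<tau>. flow C \<tau> ** M) has_vector_derivative (C ** (flow C \<tau> ** M))) (at \<tau> within S)"
proof -
  define w where "w = sqrt (rdet C)"
  have w: "w \<noteq> 0" "rdet C = w\<^sup>2"
    using assms(2) by (simp_all add: w_def)
  have "((\<lambda>\<tau>. flow C \<tau>) has_vector_derivative
      ((- sin (w * \<tau>) * w) *\<^sub>R mat 1 + cos (w * \<tau>) *\<^sub>R C)) (at \<tau> within S)"
    unfolding flow_def w_def[symmetric]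
    by (auto intro!: derivative_eq_intros simp: w(1))
  also have "(- sin (w * \<tau>) * w) *\<^sub>R mat 1 + cos (w * \<tau>) *\<^sub>R C = C ** flow C \<tau>"
    unfolding flow_def w_def[symmetric] using w
    by (simp add: matmul.add_right matmul.scaleR_right su11_square[OF assms(1)] power2_eq_square)
  finally have "((\<lambda>\<tau>. flow C \<tau>) has_vector_derivative (C ** flow C \<tau>)) (at \<tau> within S)" .
  from bounded_linear.has_vector_derivative[OF matmul.bounded_linear_left[of M] this]
  show ?thesis
    by (simp add: matrix_mul_assoc)
qed

lemma flow_lipschitz:
  fixes C M :: cmat2
  assumes "C \<in> su11" "0 < rdet C"
  shows "\<exists>L. L-lipschitz_on {a..b} (\<lambda>\<tau>. flow C (\<tau> - a) ** M)"
proof -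
  let ?f = "\<lambda>\<tau>. flow C (\<tau> - a) ** M"
  let ?D = "\<lambda>\<tau>. C ** (flow C (\<tau> - a) ** M)"
  have D: "(?f has_vector_derivative ?D \<tau>) (at \<tau> within S)" for \<tau> S
  proof -
    have "((\<lambda>\<tau>. \<tau> - a) has_vector_derivative 1) (at \<tau> within S)"
      by (auto intro!: derivative_eq_intros)
    from vector_diff_chain_within[OF this flow_derivative[OF assms]]
    show ?thesis by (simp add: o_def)
  qed
  have "continuous_on {a..b} ?f"
    using D by (meson continuous_on_vector_derivative)
  then have "continuous_on {a..b} ?D"
    by (rule matmul.continuous_on[OF continuous_on_const])
  then have "bounded (?D ` {a..b})"
    by (intro compact_imp_bounded compact_continuous_image) auto
  then obtain L where L: "\<forall>\<tau>\<in>{a..b}. norm (?D \<tau>) \<le> L" "0 < L"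
    unfolding bounded_pos by blast
  have "L-lipschitz_on {a..b} ?f"
  proof (rule bounded_derivative_imp_lipschitz)
    show "(?f has_derivative (\<lambda>h. h *\<^sub>R ?D \<tau>)) (at \<tau> within {a..b})" for \<tau>
      using D by (simp add: has_vector_derivative_def)
    show "onorm (\<lambda>h. h *\<^sub>R ?D \<tau>) \<le> L" if "\<tau> \<in> {a..b}" for \<tau>
      using L that by (intro onorm_bound) (auto simp: mult.commute[of L] intro!: mult_left_mono)
  qed (use L in auto)
  then show ?thesis ..
qed

section \<open>Trajectories of piecewise constant controls\<close>

lemma lipschitz_imp_abs_cont_on:
  assumes "L-lipschitz_on {a..b} f"
  shows "abs_cont_on a b f"
  unfolding abs_cont_on_def
proof (intro allI impI)
  fix e :: real assume e: "0 < e"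
  have L: "0 \<le> L" using assms by (rule lipschitz_on_nonneg)
  define d where "d = e / (L + 1)"
  have "(\<Sum>k\<in>D. norm (f (Sup k) - f (Inf k))) < e"
    if D: "D division_of \<Union>D" "\<Union>D \<subseteq> {a..b}" "(\<Sum>k\<in>D. Sup k - Inf k) < d" for D
  proof -
    have "norm (f (Sup k) - f (Inf k)) \<le> L * (Sup k - Inf k)" if kD: "k \<in> D" for k
    proof -
      obtain x y where k: "k = {x..y}" "x \<le> y"
        using division_ofD(3,4)[OF D(1) kD] by (metis atLeastatMost_empty_iff cbox_interval)
      moreover have "k \<subseteq> {a..b}" using D(2) kD by blast
      ultimately show ?thesis
        using lipschitz_onD[OF assms, of y x] by (auto simp: dist_norm)
    qed
    then have "(\<Sum>k\<in>D. norm (f (Sup k) - f (Inf k))) \<le> L * (\<Sum>k\<in>D. Sup k - Inf k)"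
      unfolding sum_distrib_left by (rule sum_mono)
    also have "\<dots> \<le> L * d"
      using L D(3) by (intro mult_left_mono) auto
    also have "\<dots> < e"
      using L e by (simp add: d_def field_simps)
    finally show ?thesis .
  qed
  moreover have "0 < d" using L e by (simp add: d_def)
  ultimately show "\<exists>d>0. \<forall>D. D division_of \<Union>D \<and> \<Union>D \<subseteq> {a..b} \<and> (\<Sum>k\<in>D. Sup k - Inf k) < d
      \<longrightarrow> (\<Sum>k\<in>D. norm (f (Sup k) - f (Inf k))) < e"
    by blast
qed

text \<open>Local Lipschitz continuity, rather than absolute continuity, is what is carried along: it is
  trivially preserved when two trajectories are joined, and it gives absolute continuity back.\<close>

definition steerable :: "cmat2 \<Rightarrow> cmat2 \<Rightarrow> real \<Rightarrow> cmat2 \<Rightarrow> bool" where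
  "steerable A B T M \<longleftrightarrow> 0 \<le> T \<and> (\<exists>u X. admissible_control u \<and> is_solution A B u X \<and> X T = M \<and>
     (\<forall>S\<ge>0. \<exists>L. L-lipschitz_on {0..S} X))"

lemma steerable_reachable:
  assumes "steerable A B T M"
  shows "M \<in> reachable_set A B T"
  using assms unfolding steerable_def reachable_set_def is_solution_def by blast

lemma steerable_start:
  fixes A B :: cmat2
  assumes "A + c *\<^sub>R B \<in> su11" "0 < rdet (A + c *\<^sub>R B)"
  shows "steerable A B 0 (mat 1)"
proof -
  let ?X = "\<lambda>\<tau>. flow (A + c *\<^sub>R B) \<tau>"
  have lip: "\<exists>L. L-lipschitz_on {0..S} ?X" for S
    using flow_lipschitz[OF assms, of 0 S "mat 1"] by simp
  have deriv: "(?X has_vector_derivative (A + c *\<^sub>R B) ** ?X \<tau>) (at \<tau> within S)" for \<tau> S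
    using flow_derivative[OF assms, of "mat 1"] by simp
  have "admissible_control (\<lambda>_. c)"
    by (auto simp: admissible_control_def image_constant_conv)
  moreover have "is_solution A B (\<lambda>_. c) ?X"
    using flow_in_SU11[OF assms] lip lipschitz_imp_abs_cont_on deriv
    unfolding is_solution_def by (auto intro!: AE_I2) blast+
  ultimately show ?thesis
    unfolding steerable_def using lip by (intro conjI exI[of _ "\<lambda>_. c"] exI[of _ ?X]) auto
qed

lemma AE_lebesgue_on_neq: "AE t in lebesgue_on S. t \<noteq> (T :: real)" if "S \<in> sets lebesgue"
proof -
  have "{T} \<in> null_sets lebesgue" by simp
  then have "AE t in lebesgue. t \<notin> {T}" by (rule AE_not_in)
  then show ?thesis using that by (subst AE_restrict_space_iff) auto
qed

text \<open>Follow a given trajectory up to time \<open>T\<close> and then switch to the constant control \<open>c\<close>. The corner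
  at the switching time is a null set, so the joined curve is still a Caratheodory solution.\<close>

lemma steerable_step:
  fixes A B :: cmat2
  assumes "steerable A B T M" and "0 \<le> s"
    and C: "A + c *\<^sub>R B \<in> su11" "0 < rdet (A + c *\<^sub>R B)"
  shows "steerable A B (T + s) (flow (A + c *\<^sub>R B) s ** M)"
proof -
  obtain u X where T: "0 \<le> T" and u: "admissible_control u" and X: "is_solution A B u X"
    and XT: "X T = M" and lip: "\<And>S. 0 \<le> S \<Longrightarrow> \<exists>L. L-lipschitz_on {0..S} X"
    using assms(1) unfolding steerable_def by blast
  define E where "E = (\<lambda>\<tau>. flow (A + c *\<^sub>R B) (\<tau> - T) ** M)"
  define v where "v = (\<lambda>\<tau>. if \<tau> \<le> T then u \<tau> else c)"
  define Y where "Y = (\<lambda>\<tau>. if \<tau> \<le> T then X \<tau> else E \<tau>)"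
  have ET: "E T = X T" by (simp add: E_def XT)
  have M: "M \<in> SU11" using X XT T by (auto simp: is_solution_def)
  have E_deriv: "(E has_vector_derivative (A + c *\<^sub>R B) ** E \<tau>) (at \<tau> within S)" for \<tau> S
  proof -
    have "((\<lambda>\<tau>. \<tau> - T) has_vector_derivative 1) (at \<tau> within S)"
      by (auto intro!: derivative_eq_intros)
    from vector_diff_chain_within[OF this flow_derivative[OF C]]
    show ?thesis by (simp add: o_def E_def)
  qed
  have "admissible_control v"
    unfolding admissible_control_def
  proof (intro conjI allI impI)
    show "v \<in> borel_measurable (lebesgue_on {0..})"
      unfolding v_def
    proof (rule measurable_If)
      show "u \<in> borel_measurable (lebesgue_on {0..})"
        using u by (simp add: admissible_control_def)
      have "{\<tau> \<in> space (lebesgue_on {0..}). \<tau> \<le> T} = {0..} \<inter> {..T}" by auto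
      then show "{\<tau> \<in> space (lebesgue_on {0..}). \<tau> \<le> T} \<in> sets (lebesgue_on {0..})"
        by (simp add: sets_restrict_space)
    qed simp
    have "v ` {0..S} \<subseteq> insert c (u ` {0..T})" for S
      by (auto simp: v_def)
    moreover have "bounded (insert c (u ` {0..T}))"
      using u T by (simp add: admissible_control_def)
    ultimately show "bounded (v ` {0..S})" for S
      by (meson bounded_subset)
  qed
  moreover have Y_lip: "\<exists>L. L-lipschitz_on {0..S} Y" if "0 \<le> S" for S
  proof -
    define R where "R = max S T"
    obtain L1 where L1: "L1-lipschitz_on {0..T} X" using lip T by blast
    obtain L2 where L2: "L2-lipschitz_on {T..R} E"
      unfolding E_def using flow_lipschitz[OF C] by blast
    have "(max L1 L2)-lipschitz_on {0..R} Y"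
      unfolding Y_def
      using lipschitz_on_le[OF L1, of "max L1 L2"] lipschitz_on_le[OF L2, of "max L1 L2"] ET
      by (intro lipschitz_on_concat) auto
    then have "(max L1 L2)-lipschitz_on {0..S} Y"
      by (rule lipschitz_on_subset) (simp add: R_def)
    then show ?thesis ..
  qed
  moreover have "is_solution A B v Y"
    unfolding is_solution_def
  proof (intro conjI allI impI)
    show "Y t \<in> SU11" if "0 \<le> t" for t
      using that X M flow_in_SU11[OF C] by (auto simp: Y_def E_def is_solution_def SU11_mult)
    show "Y 0 = mat 1"
      using X T by (simp add: Y_def is_solution_def)
    show "abs_cont_on 0 S Y" if "0 \<le> S" for S
      using Y_lip[OF that] lipschitz_imp_abs_cont_on by blast
    have "AE t in lebesgue_on {0..}.
        (X has_vector_derivative ((A + u t *\<^sub>R B) ** X t)) (at t within {0..})"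
      using X by (simp add: is_solution_def)
    moreover have "AE t in lebesgue_on {0..}. t \<noteq> T"
      by (rule AE_lebesgue_on_neq) simp
    moreover have "AE t in lebesgue_on {0..}. t \<in> {0..}"
      by (rule AE_I2) simp
    ultimately show "AE t in lebesgue_on {0..}.
        (Y has_vector_derivative ((A + v t *\<^sub>R B) ** Y t)) (at t within {0..})"
    proof eventually_elim
      case (elim t)
      show ?case
      proof (cases "t < T")
        case True
        have "(Y has_vector_derivative ((A + u t *\<^sub>R B) ** X t)) (at t within {0..})"
          by (rule has_vector_derivative_transform_within[OF elim(1), of "T - t"])
            (use True elim in \<open>auto simp: Y_def dist_real_def\<close>)
        then show ?thesis using True by (simp add: Y_def v_def)
      next
        case False
        then have "T < t" using elim by simp
        have "(Y has_vector_derivative ((A + c *\<^sub>R B) ** E t)) (at t within {0..})"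
          by (rule has_vector_derivative_transform_within[OF E_deriv, of "t - T"])
            (use \<open>T < t\<close> elim in \<open>auto simp: Y_def dist_real_def\<close>)
        then show ?thesis using \<open>T < t\<close> by (simp add: Y_def v_def)
      qed
    qed
  qed
  moreover have "Y (T + s) = flow (A + c *\<^sub>R B) s ** M"
    using assms(2) ET by (auto simp: Y_def E_def XT)
  ultimately show ?thesis
    unfolding steerable_def using T assms(2) by (intro conjI exI[of _ v] exI[of _ Y]) simp_all
qed

section \<open>Linearization along an elliptic constant control\<close>

text \<open>The formula is the product rule applied to the cosine and sine coefficients of the flow, whose
  frequency \<open>w\<close> has derivative \<open>w'\<close> with respect to the control.\<close>

lemma flow_control_derivative:
  fixes A B :: cmat2 and c s :: real
  defines "C \<equiv> A + c *\<^sub>R B"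
  defines "w \<equiv> sqrt (rdet C)"
  defines "w' \<equiv> polar C B / (2 * w)"
  assumes pos: "0 < rdet C"
  shows "((\<lambda>c. flow (A + c *\<^sub>R B) s) has_vector_derivative
    ((- sin (w * s) * (w' * s)) *\<^sub>R mat 1
     + ((cos (w * s) * (w' * s) * w - sin (w * s) * w') / w\<^sup>2) *\<^sub>R C
     + (sin (w * s) / w) *\<^sub>R B)) (at c)"
proof -
  let ?w = "\<lambda>c. sqrt (rdet (A + c *\<^sub>R B))"
  have w: "w > 0" using pos by (simp add: w_def)
  have w_c: "?w c = w" by (simp add: w_def C_def)
  have "((\<lambda>c. rdet A + c * polar A B + c\<^sup>2 * rdet B) has_real_derivative
      (polar A B + 2 * c * rdet B)) (at c)"
    by (auto intro!: derivative_eq_intros)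
  then have "((\<lambda>c. rdet (A + c *\<^sub>R B)) has_real_derivative polar C B) (at c)"
    by (simp add: rdet_pencil polar_pencil C_def)
  from DERIV_chain2[OF DERIV_real_sqrt this] pos
  have dw: "(?w has_real_derivative w') (at c)"
    by (simp add: C_def w_def w'_def field_simps)
  have d1: "((\<lambda>c. cos (?w c * s)) has_real_derivative (- sin (w * s) * (w' * s))) (at c)"
    by (rule derivative_eq_intros refl dw)+ (simp add: w_c)
  have quotient: "((\<lambda>c. sin (v c * s) / v c) has_real_derivative
      ((cos (w * s) * (w' * s) * w - sin (w * s) * w') / w\<^sup>2)) (at c)"
    if "(v has_real_derivative w') (at c)" "v c = w" for v
    using w that by (auto intro!: derivative_eq_intros simp: power2_eq_square)
  note d2 = quotient[OF dw w_c]
  have d3: "((\<lambda>c. A + c *\<^sub>R B) has_vector_derivative B) (at c)"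
    by (auto intro!: derivative_eq_intros)
  have d4: "((\<lambda>c. mat 1 :: cmat2) has_vector_derivative 0) (at c)"
    by simp
  show ?thesis
    unfolding flow_def
    using has_vector_derivative_add[OF has_vector_derivative_scaleR[OF d1 d4] has_vector_derivative_scaleR[OF d2 d3]]
    by (simp add: w_c C_def add_ac)
qed

text \<open>The anticommutator with \<open>Q\<close> kills \<open>N\<close> and \<open>Q N\<close> and isolates the coefficient of \<open>Q\<close>. The other two
  terms are \<open>(b + d Q) N\<close>, where \<open>b + d Q\<close> is invertible unless it vanishes, because \<open>Q\<close> is an
  imaginary unit.\<close>

lemma anticommuting_basis_independent:
  fixes Q N :: cmat2
  assumes QQ: "Q ** Q = - mat 1" and NQ: "N ** Q = - (Q ** N)" and "N \<noteq> 0"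
    and zero: "a *\<^sub>R Q + b *\<^sub>R N + d *\<^sub>R (Q ** N) = 0"
  shows "a = 0" "b = 0" "d = 0"
proof -
  have QQX: "Q ** (Q ** X) = - X" for X :: cmat2
    by (simp add: matrix_mul_assoc QQ matmul.minus_left)
  have NQX: "N ** (Q ** X) = - (Q ** (N ** X))" for X :: cmat2
    by (simp add: matrix_mul_assoc NQ matmul.minus_left)
  note expand = matmul.add_left matmul.add_right matmul.scaleR_left matmul.scaleR_right
    matmul.minus_left matmul.minus_right matmul.diff_left matmul.diff_right matrix_mul_assoc[symmetric]
    QQ NQ QQX NQX
  have "(a *\<^sub>R Q + b *\<^sub>R N + d *\<^sub>R (Q ** N)) ** Q + Q ** (a *\<^sub>R Q + b *\<^sub>R N + d *\<^sub>R (Q ** N))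
      = - ((2 * a) *\<^sub>R mat 1)"
    by (simp add: expand scaleR_2[symmetric])
  then have "(2 * a) *\<^sub>R (mat 1 :: cmat2) = 0"
    unfolding zero by simp
  moreover have "(mat 1 :: cmat2) \<noteq> 0"
    by (simp add: cmat2_eq_iff mat_def)
  ultimately show a: "a = 0" by simp
  have "(b *\<^sub>R mat 1 - d *\<^sub>R Q) ** (b *\<^sub>R N + d *\<^sub>R (Q ** N)) = (b\<^sup>2 + d\<^sup>2) *\<^sub>R N"
    by (simp add: expand scaleR_add_left scaleR_add_right scaleR_diff_right power2_eq_square mult.commute)
  moreover have "b *\<^sub>R N + d *\<^sub>R (Q ** N) = 0" using zero a by simp
  ultimately have "b\<^sup>2 + d\<^sup>2 = 0" using \<open>N \<noteq> 0\<close> by simp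
  then show "b = 0" "d = 0"
    by (simp_all add: add_nonneg_eq_0_iff)
qed

lemma eighth_turn_square:
  fixes Q :: cmat2 and r :: real
  assumes QQ: "Q ** Q = - mat 1" and r: "r * r = 1 / 2"
  shows "(r *\<^sub>R mat 1 + r *\<^sub>R Q) ** (r *\<^sub>R mat 1 + r *\<^sub>R Q) = Q"
proof -
  have "(1 / 2) *\<^sub>R X + (1 / 2) *\<^sub>R X = X" for X :: cmat2
    by (simp add: scaleR_add_left[symmetric])
  then show ?thesis
    by (simp add: matmul.add_left matmul.add_right matmul.scaleR_left matmul.scaleR_right QQ r
        scaleR_add_right scaleR_diff_right)
qed

text \<open>\<open>P = exp (\<pi> Q / 4)\<close> is an eighth of a full turn and \<open>- P = P\<^sup>-\<^sup>3\<close>, so the products are the tangent vectors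
  \<open>P\<^sup>-\<^sup>j (P\<^sup>-\<^sup>1 E) P\<^sup>j\<close> for \<open>j = 0, 1, 2\<close>. Conjugation by \<open>P\<close> fixes \<open>Q\<close> and turns the plane spanned by \<open>N\<close> and \<open>Q N\<close>
  by a quarter; this doubling of the angle is why an eighth of a turn is the right duration: three
  successive positions of a vector with nonzero components along \<open>Q\<close> and in the plane are independent,
  whereas with half turns in the plane the first and the third would coincide.\<close>

lemma eighth_turn_products:
  fixes Q N :: cmat2 and r \<sigma> z :: real
  assumes QQ: "Q ** Q = - mat 1" and NQ: "N ** Q = - (Q ** N)" and r: "r * r = 1 / 2"
  defines "P \<equiv> r *\<^sub>R mat 1 + r *\<^sub>R Q"
  defines "E \<equiv> P ** (\<sigma> *\<^sub>R Q) + z *\<^sub>R N"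
  shows "(- P) ** (P ** (P ** E)) = \<sigma> *\<^sub>R Q + (z * r) *\<^sub>R (N - Q ** N)"
    and "(- P) ** (P ** (E ** P)) = \<sigma> *\<^sub>R Q - (z * r) *\<^sub>R (N + Q ** N)"
    and "(- P) ** (E ** (P ** P)) = \<sigma> *\<^sub>R Q - (z * r) *\<^sub>R (N - Q ** N)"
proof -
  have QQX: "Q ** (Q ** X) = - X" for X :: cmat2
    by (simp add: matrix_mul_assoc QQ matmul.minus_left)
  have NQX: "N ** (Q ** X) = - (Q ** (N ** X))" for X :: cmat2
    by (simp add: matrix_mul_assoc NQ matmul.minus_left)
  note expand = matmul.add_left matmul.add_right matmul.scaleR_left matmul.scaleR_right
    matmul.minus_left matmul.minus_right matmul.diff_left matmul.diff_right matrix_mul_assoc[symmetric]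
    QQ NQ QQX NQX
  have PP: "P ** P = Q"
    unfolding P_def using QQ r by (rule eighth_turn_square)
  have PPX: "P ** (P ** X) = Q ** X" for X
    by (simp add: matrix_mul_assoc PP)
  have QP: "Q ** P = P ** Q"
    by (simp add: P_def expand)
  have QPX: "Q ** (P ** X) = P ** (Q ** X)" for X
    by (simp add: matrix_mul_assoc QP)
  note words = expand PP PPX QP QPX E_def
  show "(- P) ** (P ** (P ** E)) = \<sigma> *\<^sub>R Q + (z * r) *\<^sub>R (N - Q ** N)"
    by (simp add: words) (simp add: P_def expand scaleR_add_right scaleR_diff_right)
  show "(- P) ** (P ** (E ** P)) = \<sigma> *\<^sub>R Q - (z * r) *\<^sub>R (N + Q ** N)"
    by (simp add: words) (simp add: P_def expand scaleR_add_right scaleR_diff_right)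
  show "(- P) ** (E ** (P ** P)) = \<sigma> *\<^sub>R Q - (z * r) *\<^sub>R (N - Q ** N)"
    by (simp add: words) (simp add: P_def expand scaleR_add_right scaleR_diff_right)
qed

section \<open>From a surjective linearization to a neighbourhood of the identity\<close>

text \<open>Near the identity the real part of the upper left entry is determined by the remaining
  coordinates and its sign, so these three real coordinates form a chart of the group. The type
  is chosen so that the three control values can be taken from the same Euclidean space.\<close>

definition chart :: "cmat2 \<Rightarrow> real \<times> complex" where
  "chart M = (Im (M $ 1 $ 1), M $ 1 $ 2)"

lemma bounded_linear_chart: "bounded_linear chart"
  unfolding linear_conv_bounded_linear[symmetric]
  by (rule linearI) (simp_all add: chart_def)

lemma chart_su11_eq_0:
  assumes "M \<in> su11" "chart M = 0"
  shows "M = 0"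
proof -
  obtain r b where "M = su_mat (of_real r * \<i>) b" using assms(1) su11_iff by blast
  then show ?thesis using assms(2) by (simp add: chart_def cmat2_eq_iff zero_prod_def)
qed

lemma chart_SU11_inj:
  assumes "M \<in> SU11" "N \<in> SU11" "chart M = chart N" "0 < Re (M $ 1 $ 1)" "0 < Re (N $ 1 $ 1)"
  shows "M = N"
proof -
  obtain a b where M: "M = su_mat a b" and ab: "(cmod a)\<^sup>2 - (cmod b)\<^sup>2 = 1"
    using assms(1) by (rule SU11_E)
  obtain c d where N: "N = su_mat c d" and cd: "(cmod c)\<^sup>2 - (cmod d)\<^sup>2 = 1"
    using assms(2) by (rule SU11_E)
  have eq: "Im a = Im c" "b = d" using assms(3) by (simp_all add: chart_def M N)
  then have "(Re a)\<^sup>2 = (Re c)\<^sup>2" using ab cd unfolding cmod_power2 by simp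
  then have "Re a = Re c" using assms(4,5) by (simp add: M N power2_eq_iff)
  then show ?thesis using eq by (simp add: M N cmat2_eq_iff complex_eq_iff)
qed

text \<open>The open mapping theorem of Sussmann needs, besides continuity, only the derivative at \<open>x\<close>; restricting the parameters to the right half plane of the upper left entry makes the
  chart injective on all matrices that occur.\<close>

lemma interior_in_SU11_from_chart:
  fixes F :: "'a::real_normed_vector \<Rightarrow> cmat2"
  assumes "open S" "x \<in> S" and F: "\<And>p. p \<in> S \<Longrightarrow> F p \<in> SU11" and cont: "continuous_on S F"
    and "F x = mat 1" and deriv: "((\<lambda>p. chart (F p)) has_derivative f') (at x)"
    and "bounded_linear g'" "f' \<circ> g' = id"
  shows "mat 1 \<in> (top_of_set SU11) interior_of (F ` S)"
proof -
  define T where "T = S \<inter> F -` {M. 0 < Re (M $ 1 $ 1)}"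
  have T_sub: "T \<subseteq> S" by (simp add: T_def)
  have right_half: "open {M :: cmat2. 0 < Re (M $ 1 $ 1)}"
    by (intro open_Collect_less continuous_intros)
  have "open T"
    unfolding T_def using cont \<open>open S\<close> right_half by (rule continuous_open_preimage)
  moreover have "x \<in> T" using \<open>x \<in> S\<close> \<open>F x = mat 1\<close> by (simp add: T_def mat_def)
  moreover have "continuous_on S (\<lambda>p. chart (F p))"
    using bounded_linear.continuous_on[OF bounded_linear_chart cont] .
  ultimately have x: "chart (F x) \<in> interior ((\<lambda>p. chart (F p)) ` T)"
    using assms by (intro sussmann_open_mapping[of S _ x f' g']) (auto simp: interior_open T_sub)
  define V where "V = {M. 0 < Re (M $ 1 $ 1)} \<inter> chart -` interior ((\<lambda>p. chart (F p)) ` T)"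
  have "open V"
    unfolding V_def
    using right_half open_vimage[OF open_interior linear_continuous_on[OF bounded_linear_chart]]
    by (rule open_Int)
  moreover have "mat 1 \<in> V"
    using x \<open>F x = mat 1\<close> by (simp add: V_def mat_def)
  moreover have "SU11 \<inter> V \<subseteq> F ` S"
  proof
    fix M assume M: "M \<in> SU11 \<inter> V"
    then have "chart M \<in> (\<lambda>p. chart (F p)) ` T"
      using interior_subset by (fastforce simp: V_def)
    then obtain p where p: "p \<in> T" "chart M = chart (F p)" by blast
    then have "M = F p"
      using M F by (intro chart_SU11_inj) (auto simp: T_def V_def)
    then show "M \<in> F ` S" using p(1) by (auto simp: T_def)
  qed
  ultimately show ?thesis
    unfolding interior_of_def using mat_1_in_SU11 openin_open_Int by blast
qed

lemma continuous_on_flow_control: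
  fixes A B :: cmat2
  shows "continuous_on {c. 0 < rdet (A + c *\<^sub>R B)} (\<lambda>c. flow (A + c *\<^sub>R B) s)"
  by (rule continuous_on_vector_derivative)
    (blast intro: has_vector_derivative_at_within flow_control_derivative)

section \<open>Local controllability\<close>

text \<open>The reference control is the constant \<open>c\<close>. Its value is perturbed on three arcs of an eighth of a
  turn each, and the remaining arc, of duration \<open>q\<close>, brings the reference trajectory back to the
  identity. Decompose \<open>B = w' Q + N\<close> along \<open>Q = C / w\<close> and orthogonally to it. The hypothesis
  on \<^term>\<open>polar C B\<close> says that the component along \<open>Q\<close> does not vanish, the hypothesis that \<open>B\<close> is no
  multiple of \<open>C\<close> that \<open>N\<close> does not vanish; together they make the three tangent vectors independent.\<close>

lemma three_arc_interior:
  fixes A B :: cmat2 and c s q :: real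
  defines "C \<equiv> A + c *\<^sub>R B"
  defines "w \<equiv> sqrt (rdet C)"
  defines "W \<equiv> {c. 0 < rdet (A + c *\<^sub>R B)}"
  assumes su11: "A \<in> su11" "B \<in> su11" and pos: "0 < rdet C" and "polar C B \<noteq> 0"
    and indep: "\<And>k. B \<noteq> k *\<^sub>R C"
    and s: "w * s = pi / 4" and q: "cos (w * q) = - (sqrt 2 / 2)" "sin (w * q) = - (sqrt 2 / 2)"
  shows "mat 1 \<in> (top_of_set SU11) interior_of
    {flow C q ** (flow (A + c3 *\<^sub>R B) s ** (flow (A + c2 *\<^sub>R B) s ** flow (A + c1 *\<^sub>R B) s))
      | c1 c2 c3. c1 \<in> W \<and> c2 \<in> W \<and> c3 \<in> W}"
proof -
  define G where "G = (\<lambda>c. flow (A + c *\<^sub>R B) s)"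
  define r where "r = sqrt 2 / 2"
  define w' where "w' = polar C B / (2 * w)"
  define Q where "Q = (1 / w) *\<^sub>R C"
  define N where "N = B - w' *\<^sub>R Q"
  have pencil_su11: "A + b *\<^sub>R B \<in> su11" for b
    using su11_combination[OF su11, of 1 b] by simp
  then have C_su11: "C \<in> su11" by (simp add: C_def)
  have w: "w > 0" "rdet C = w\<^sup>2" using pos by (simp_all add: w_def)
  have r: "r * r = 1 / 2" "r > 0" by (simp_all add: r_def)
  have w': "w' \<noteq> 0" using w \<open>polar C B \<noteq> 0\<close> by (simp add: w'_def)
  have s_pos: "s > 0" using s w(1) by (metis pi_gt_zero zero_less_divide_iff zero_less_mult_pos zero_less_numeral)
  have QQ: "Q ** Q = - mat 1"
    using w by (simp add: Q_def matmul.scaleR_left matmul.scaleR_right C_su11 su11_square power2_eq_square)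
  have BQ: "B ** Q + Q ** B = - ((2 * w') *\<^sub>R mat 1)"
  proof -
    have "B ** Q + Q ** B = (1 / w) *\<^sub>R (C ** B + B ** C)"
      by (simp add: Q_def matmul.scaleR_left matmul.scaleR_right scaleR_add_right add.commute)
    then show ?thesis
      using w(1) by (simp add: su11_anticommutator[OF C_su11 \<open>B \<in> su11\<close>] w'_def)
  qed
  have NQ: "N ** Q = - (Q ** N)"
  proof -
    have "N ** Q + Q ** N = (B ** Q + Q ** B) - (2 * w') *\<^sub>R (Q ** Q)"
      by (simp add: N_def matmul.diff_left matmul.diff_right matmul.scaleR_left matmul.scaleR_right
          scaleR_2 scaleR_scaleR[symmetric] del: scaleR_scaleR)
    then show ?thesis by (simp add: BQ QQ eq_neg_iff_add_eq_0)
  qed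
  have "N \<noteq> 0"
    using indep[of "w' / w"] by (auto simp: N_def Q_def)
  have Q_su11: "Q \<in> su11" and N_su11: "N \<in> su11"
    using su11_combination[OF C_su11 C_su11, of "1 / w" 0] su11_combination[OF \<open>B \<in> su11\<close> C_su11, of 1 "- w' / w"]
    by (simp_all add: Q_def N_def)
  define P where "P = r *\<^sub>R mat 1 + r *\<^sub>R Q"
  define E where "E = P ** ((s * w') *\<^sub>R Q) + (r / w) *\<^sub>R N"
  have GP: "G c = P"
    unfolding G_def C_def[symmetric] flow_def w_def[symmetric] s
    by (simp add: P_def Q_def r_def cos_45 sin_45)
  have T: "flow C q = - P"
    using q by (simp add: flow_def w_def[symmetric] P_def Q_def r_def)
  note products = eighth_turn_products[OF QQ NQ r(1), where \<sigma>="s * w'" and z="r / w", folded P_def, folded E_def]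
  have G_deriv: "(G has_vector_derivative E) (at c)"
  proof -
    \<comment> \<open>\<open>E\<close> separates the change of speed on the circle of \<open>C\<close> from the tilt of the axis caused by \<open>N\<close>.\<close>
    have "E = (- r * (w' * s)) *\<^sub>R mat 1 + ((r * (w' * s) * w - r * w') / w\<^sup>2) *\<^sub>R C + (r / w) *\<^sub>R B"
    proof -
      have "C = w *\<^sub>R Q" using w by (simp add: Q_def)
      then show ?thesis
        using w(1) by (simp add: E_def P_def N_def matmul.add_left matmul.scaleR_left matmul.scaleR_right QQ
            algebra_simps diff_divide_distrib power2_eq_square)
    qed
    then show ?thesis
      using flow_control_derivative[of A c B s] pos s
      by (simp add: G_def C_def[symmetric] w_def[symmetric] w'_def[symmetric] r_def cos_45 sin_45)
  qed
  define F where "F = (\<lambda>p. flow C q ** (G (c + Im (snd p)) ** (G (c + Re (snd p)) ** G (c + fst p))))"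
  define S where "S = {p. c + fst p \<in> W \<and> c + Re (snd p) \<in> W \<and> c + Im (snd p) \<in> W}"
  define F' where "F' = (\<lambda>h. - P ** (P ** (P ** (fst h *\<^sub>R E) + (Re (snd h) *\<^sub>R E) ** P)
      + (Im (snd h) *\<^sub>R E) ** (P ** P)))"
  have arc: "((\<lambda>p. G (c + l p)) has_derivative (\<lambda>h. l h *\<^sub>R E)) (at 0)"
    if "bounded_linear l" for l :: "real \<times> complex \<Rightarrow> real"
  proof -
    have l0: "l 0 = 0" using that by (rule linear_simps)
    have "((\<lambda>p. c + l p) has_derivative l) (at 0)"
      by (auto intro!: derivative_eq_intros bounded_linear_imp_has_derivative that)
    moreover have "(G has_derivative (\<lambda>x. x *\<^sub>R E)) (at (c + l 0))"
      using G_deriv by (simp add: l0 has_vector_derivative_def)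
    ultimately show ?thesis
      by (rule has_derivative_compose)
  qed
  have F_deriv: "(F has_derivative F') (at 0)"
  proof -
    have l: "bounded_linear (fst :: real \<times> complex \<Rightarrow> real)"
      "bounded_linear (\<lambda>p :: real \<times> complex. Re (snd p))" "bounded_linear (\<lambda>p :: real \<times> complex. Im (snd p))"
      by (auto intro!: bounded_linear_fst bounded_linear_compose[OF bounded_linear_Re bounded_linear_snd]
          bounded_linear_compose[OF bounded_linear_Im bounded_linear_snd])
    show ?thesis
      unfolding F_def T
      by (rule has_derivative_eq_rhs, rule bounded_linear.has_derivative[OF matmul.bounded_linear_right],
          rule matmul.FDERIV[OF arc[OF l(3)] matmul.FDERIV[OF arc[OF l(2)] arc[OF l(1)]]])
        (simp add: F'_def GP)
  qed
  have F'_eq: "F' h = ((fst h + Re (snd h) + Im (snd h)) * (s * w')) *\<^sub>R Q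
      + ((fst h - Re (snd h) - Im (snd h)) * (r / w * r)) *\<^sub>R N
      + ((Im (snd h) - fst h - Re (snd h)) * (r / w * r)) *\<^sub>R (Q ** N)" for h
  proof -
    have "F' h = fst h *\<^sub>R (- P ** (P ** (P ** E))) + Re (snd h) *\<^sub>R (- P ** (P ** (E ** P)))
        + Im (snd h) *\<^sub>R (- P ** (E ** (P ** P)))"
      by (simp add: F'_def matmul.add_right matmul.scaleR_right matmul.scaleR_left matmul.minus_left)
    then show ?thesis
      unfolding products by (simp add: algebra_simps)
  qed
  have "linear (\<lambda>h. chart (F' h))"
    using bounded_linear.linear[OF bounded_linear_compose[OF bounded_linear_chart has_derivative_bounded_linear[OF F_deriv]]] .
  moreover have "inj (\<lambda>h. chart (F' h))"
    unfolding linear_injective_0[OF calculation]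
  proof (intro allI impI)
    fix h assume "chart (F' h) = 0"
    moreover have "F' h \<in> su11"
      unfolding F'_eq su11_def
      using Q_su11 N_su11 su11_anticommuting_product[OF Q_su11 N_su11 NQ] unfolding su11_def
      by (intro span_add span_scale)
    ultimately have "F' h = 0" by (intro chart_su11_eq_0)
    note coeffs = anticommuting_basis_independent[OF QQ NQ \<open>N \<noteq> 0\<close> this[unfolded F'_eq]]
    have "fst h + Re (snd h) + Im (snd h) = 0" "fst h - Re (snd h) - Im (snd h) = 0"
      "Im (snd h) - fst h - Re (snd h) = 0"
      using coeffs w' s_pos r(2) w(1) by auto
    then have "fst h = 0" "Re (snd h) = 0" "Im (snd h) = 0" by linarith+
    then show "h = 0" by (simp add: prod_eq_iff complex_eq_iff)
  qed
  ultimately have "surj (\<lambda>h. chart (F' h))"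
    by (rule linear_inj_imp_surj)
  then obtain g' where g': "linear g'" "(\<lambda>h. chart (F' h)) \<circ> g' = id"
    using linear_surjective_right_inverse[OF \<open>linear (\<lambda>h. chart (F' h))\<close>] by blast
  have "open W"
    unfolding W_def rdet_pencil by (intro open_Collect_less continuous_intros)
  have "mat 1 \<in> (top_of_set SU11) interior_of (F ` S)"
  proof (rule interior_in_SU11_from_chart)
    have "S = (\<lambda>p. c + fst p) -` W \<inter> (\<lambda>p. c + Re (snd p)) -` W \<inter> (\<lambda>p. c + Im (snd p)) -` W"
      by (auto simp: S_def)
    also have "open \<dots>"
      by (intro open_Int open_vimage \<open>open W\<close> continuous_intros)
    finally show "open S" .
    show "0 \<in> S" using pos by (simp add: S_def W_def C_def)
    have "G b \<in> SU11" if "b \<in> W" for b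
      using that flow_in_SU11[OF pencil_su11] by (simp add: G_def W_def)
    moreover have "flow C q \<in> SU11"
      using flow_in_SU11[OF C_su11 pos] .
    ultimately show "F p \<in> SU11" if "p \<in> S" for p
      using that by (simp add: F_def S_def SU11_mult)
    have "continuous_on W G"
      unfolding W_def G_def by (rule continuous_on_flow_control)
    then have "continuous_on S (\<lambda>p. G (c + fst p))" "continuous_on S (\<lambda>p. G (c + Re (snd p)))"
        "continuous_on S (\<lambda>p. G (c + Im (snd p)))"
      by (rule continuous_on_compose2; auto simp: S_def intro!: continuous_intros)+
    then show "continuous_on S F"
      unfolding F_def by (intro matmul.continuous_on[OF continuous_on_const] matmul.continuous_on)
    show "F 0 = mat 1"
    proof -
      have "P ** P = Q" unfolding P_def by (rule eighth_turn_square[OF QQ r(1)])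
      then have "P ** (P ** (P ** P)) = - mat 1"
        using QQ by (metis matrix_mul_assoc)
      then show ?thesis by (simp add: F_def GP T matmul.minus_left)
    qed
    show "((\<lambda>p. chart (F p)) has_derivative (\<lambda>h. chart (F' h))) (at 0)"
      by (rule bounded_linear.has_derivative[OF bounded_linear_chart F_deriv])
    show "bounded_linear g'" using g'(1) by (simp add: linear_conv_bounded_linear)
    show "(\<lambda>h. chart (F' h)) \<circ> g' = id" by (rule g'(2))
  qed
  then show ?thesis
    by (rule set_mp[OF interior_of_mono, rotated]) (auto simp: F_def S_def G_def)
qed

lemma elliptic_rdet_pos:
  assumes "B \<in> su11" "mat_ip B (dagger B) < 0"
  shows "0 < rdet B"
proof -
  have "dagger (dagger B) = B" by (simp add: dagger_def vec_eq_iff)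
  then have "mat_ip B (dagger B) = - of_real (4 * rdet B)"
    by (simp add: mat_ip_def su11_square[OF assms(1)] trace_def sum_2 mat_def scaleR_conv_of_real[where 'a=complex])
  then show ?thesis using assms(2) by (simp add: less_complex_def)
qed

theorem mainTheorem3:
  fixes A B :: cmat2
  assumes "A \<in> su11" and "B \<in> su11"
    and "A \<noteq> B" and "independent {A, B}"
    and "mat_ip B (dagger B) < 0"
  shows "small_time_local_controllable A B"
  unfolding small_time_local_controllable_def
proof (intro allI impI)
  fix t :: real assume t: "0 < t"
  have b: "0 < rdet B" using assms(2,5) by (rule elliptic_rdet_pos)
  have pencil: "A + c *\<^sub>R B \<in> su11" for c
    using su11_combination[OF assms(1,2), of 1 c] by simp
  \<comment> \<open>\<open>k\<close> counts the full turns made in time \<open>t\<close>; it only has to be large enough for the frequency \<open>w\<close> to be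
      attained by some constant control.\<close>
  obtain k :: nat where k: "t * (1 + \<bar>rdet A\<bar>) / (2 * pi) < real k"
    using reals_Archimedean2 by blast
  define w where "w = 2 * pi * real k / t"
  have k_pos: "real k > 0"
    using k t by (smt (verit) divide_nonneg_pos mult_nonneg_nonneg pi_gt_zero)
  have "1 + \<bar>rdet A\<bar> < w" using k t by (simp add: w_def field_simps)
  moreover from this have "w * 1 \<le> w * w" by (intro mult_left_mono) auto
  ultimately have w: "w > 0" "rdet A < w\<^sup>2" by (auto simp: power2_eq_square)
  \<comment> \<open>\<open>c\<close> is the larger root of \<open>det (A + c B) = w\<^sup>2\<close>; the discriminant \<open>D\<close> is positive because \<open>det B > 0\<close>, and being
      a simple root gives \<open>polar C B \<noteq> 0\<close>.\<close>
  define D where "D = (polar A B)\<^sup>2 + 4 * rdet B * (w\<^sup>2 - rdet A)"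
  have D: "D > 0" using w b by (simp add: D_def add_nonneg_pos)
  define c where "c = (sqrt D - polar A B) / (2 * rdet B)"
  define C where "C = A + c *\<^sub>R B"
  have root: "2 * rdet B * c + polar A B = sqrt D" using b by (simp add: c_def)
  have "4 * rdet B * rdet C = (2 * rdet B * c + polar A B)\<^sup>2 - (polar A B)\<^sup>2 + 4 * rdet B * rdet A"
    by (simp add: C_def rdet_pencil power2_eq_square algebra_simps)
  also have "\<dots> = 4 * rdet B * w\<^sup>2"
    unfolding root using D by (simp add: D_def algebra_simps)
  finally have C_det: "rdet C = w\<^sup>2" using b by simp
  then have C_w: "sqrt (rdet C) = w" using w by simp
  have "polar C B = sqrt D" using root by (simp add: C_def polar_pencil algebra_simps)
  then have C_polar: "polar C B \<noteq> 0" using D by simp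
  have indep: "B \<noteq> k *\<^sub>R C" for k
  proof
    assume "B = k *\<^sub>R C"
    then have eq: "k *\<^sub>R A = (1 - k * c) *\<^sub>R B"
      by (simp add: C_def algebra_simps)
    have "A \<notin> span {B}" and "B \<noteq> 0"
      using assms(3,4) by (auto simp: independent_insert dependent_zero)
    show False
    proof (cases "k = 0")
      case True
      then show False using eq \<open>B \<noteq> 0\<close> by simp
    next
      case False
      then have "A = ((1 - k * c) / k) *\<^sub>R B"
        using arg_cong[OF eq, of "\<lambda>X. (1 / k) *\<^sub>R X"] by simp
      then show False using \<open>A \<notin> span {B}\<close> by (metis span_base span_scale singletonI)
    qed
  qed
  define s where "s = t / (8 * real k)"
  define q where "q = t - 3 * s"
  have s_pos: "0 < s" using t k_pos by (simp add: s_def)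
  have ws: "w * s = pi / 4" using t k_pos by (simp add: w_def s_def)
  have wq: "w * q = 2 * pi * real k - 3 * (pi / 4)"
  proof -
    have "w * q = w * t - 3 * (w * s)" by (simp add: q_def algebra_simps)
    then show ?thesis unfolding ws using t by (simp add: w_def)
  qed
  have "real k \<ge> 1" using k_pos by simp
  then have q_pos: "0 \<le> q"
    using t k_pos by (simp add: q_def s_def field_simps)
  have three: "cos (3 * (pi / 4)) = - (sqrt 2 / 2)" "sin (3 * (pi / 4)) = sqrt 2 / 2"
    using cos_add[of "pi / 2" "pi / 4"] sin_add[of "pi / 2" "pi / 4"] by (simp_all add: cos_45 sin_45)
  have turn: "cos (2 * pi * real k) = 1" "sin (2 * pi * real k) = 0"
    using cos_2npi[of k] sin_2npi[of k] by (simp_all add: mult_ac)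
  have q_trig: "cos (w * q) = - (sqrt 2 / 2)" "sin (w * q) = - (sqrt 2 / 2)"
    unfolding wq cos_diff sin_diff three turn by simp_all
  have "mat 1 \<in> (top_of_set SU11) interior_of
      {flow C q ** (flow (A + c3 *\<^sub>R B) s ** (flow (A + c2 *\<^sub>R B) s ** flow (A + c1 *\<^sub>R B) s))
        | c1 c2 c3. c1 \<in> {c. 0 < rdet (A + c *\<^sub>R B)} \<and> c2 \<in> {c. 0 < rdet (A + c *\<^sub>R B)}
          \<and> c3 \<in> {c. 0 < rdet (A + c *\<^sub>R B)}}"
    by (rule three_arc_interior[where A=A and B=B and c=c and s=s and q=q, folded C_def, unfolded C_w])
      (use assms(1,2) C_det w C_polar indep ws q_trig in simp_all)
  then show "mat 1 \<in> (top_of_set SU11) interior_of (reachable_set A B t)"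
  proof (rule set_mp[OF interior_of_mono, rotated], safe)
    fix c1 c2 c3
    assume pos: "0 < rdet (A + c1 *\<^sub>R B)" "0 < rdet (A + c2 *\<^sub>R B)" "0 < rdet (A + c3 *\<^sub>R B)"
    have "steerable A B (0 + s + s + s + q)
        (flow C q ** (flow (A + c3 *\<^sub>R B) s ** (flow (A + c2 *\<^sub>R B) s ** (flow (A + c1 *\<^sub>R B) s ** mat 1))))"
      unfolding C_def
      using s_pos q_pos pos C_det w(1) pencil
      by (intro steerable_step steerable_start[of A c B]) (auto simp: C_def)
    then show "flow C q ** (flow (A + c3 *\<^sub>R B) s ** (flow (A + c2 *\<^sub>R B) s ** flow (A + c1 *\<^sub>R B) s))
        \<in> reachable_set A B t"
      by (intro steerable_reachable) (simp add: q_def)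
  qed
qed

end
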